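(* The following two assertions are equivalent. (i) (1-2-3 Conjecture) Every finite simple graph $G$ with no connected component of order less than $3$ admits a local irregular labeling with labels in $\{1,2,3\}$, i.e. $\chi^\Sigma(G)\le 3$. (ii) For every simple finite unweighted graph $G$ with $|V(G)|\ge2$ and with no connected component isomorphic to $K_2$, there exists $$p\in s\left(I(G)*C(1,2,3)_{|V(G)|}*M[x]\right)$$ such that no coefficient of $p$ is a nonzero purely imaginary number.
   Context: A labeling $\ell\colon E(G)\to\{1,\dots,k\}$ is local irregular if for every edge $\{u,v\}\in E(G)$ the sum of labels of edges incident to $u$ differs from the sum of labels of edges incident to $v$. $\chi^\Sigma(G)$ is the minimum $k$ for which such a labeling exists. For a commutative ring $R$, an $R$-weighted complete graph $G$ is a complete graph on a finite vertex set $V(G)$ with a weight function $\nu_G$ from the set of all 2-element subsets of $V(G)$ to $R$. Weights in a subring are regarded as weights in the larger ring; here everything may be taken over $\mathbb{C}[x]$. If $H,G$ are $R$-weighted complete graphs with $|V(H)|=|V(G)|$ and $f\colon V(H)\to V(G)$ is a bijection, $H*_fG$ is the $R$-weighted complete graph on $V(H)$ with $\nu_{H*_fG}(e)=\nu_H(e)\cdot\nu_G(f(e))$, where $f(\{a,b\})=\{f(a),f(b)\}$. Put $H*G=\{H*_fG : f\colon V(H)\to V(G)\text{ a bijection}\}$, and for sets $\mathscr{H},\mathscr{G}$ of $R$-weighted complete graphs of the same order $\mathscr{H}*\mathscr{G}=\bigcup_{H\in\mathscr{H},\,G\in\mathscr{G}}H*G$. A single graph is identified with the corresponding singleton. The operation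 $*$ on sets is associative. For an $R$-weighted complete graph $G$, $s(G)=\sum_e\nu_G(e)$ (sum over all 2-element subsets $e$ of $V(G)$), and $s(\mathscr{G})=\{s(G):G\in\mathscr{G}\}$. Weighted complete graphs on the same vertex set are added and multiplied by scalars edgewise; for sets, $\mathscr{H}_1+\mathscr{H}_2=\{H_1+H_2: H_1\in\mathscr{H}_1,H_2\in\mathscr{H}_2\}$. For an unweighted graph $G$, $I(G)$ is the weighted complete graph on $V(G)$ with weight $1$ on edges of $G$ and $0$ on non-edges. Let $n=|V(G)|$. For a set $\mathscr{G}$ of weighted complete graphs of order $n$, $\mathscr{G}^{*m}$ is the $m$-fold product $\mathscr{G}*\cdots*\mathscr{G}$; if there is $m_0$ with $\mathscr{G}^{*m}=\mathscr{G}^{*m_0}$ for all $m\ge m_0$, then $\mathscr{G}^{*\infty}=\mathscr{G}^{*m_0}$; and $G^{*\infty}=\{G\}^{*\infty}$. Let $K_n$ be the complete graph on $\{1,\dots,n\}$ and $K_n\setminus e$ the graph $K_n$ with one (arbitrary fixed) edge $e$ removed. For $k\ge1$, $C(1,\dots,k)_n=\sum_{i=1}^{k-1}\left(I(K_n\setminus e)^{*\infty}\cup\{I(K_n)\}\right)+I(K_n)$, a sum of sets in the sense $\mathscr{H}_1+\mathscr{H}_2=\{H_1+H_2: H_1\in\mathscr{H}_1,H_2\in\mathscr{H}_2\}$, with $H_1+H_2$ the edgewise sum; here $k=3$. For $1\le j<k\le n$, $J(j,k)$ is the $\mathbb{C}$-weighted complete graph on $\{1,\dots,n\}$ with $$\nu_{J(j,k)}(\{v,u\})=\begin{cases}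 i&\text{if }\{v,u\}=\{j,k\}\\ 1&\text{if }\{j,k\}\cap\{v,u\}=\{j\}\\ -1&\text{if }\{j,k\}\cap\{v,u\}=\{k\}\\ 0&\text{otherwise,}\end{cases}$$ where $i$ is the imaginary unit. Then $M[x]=\sum_{1\le j<k\le n}x^{\psi(k,j)}\cdot J(j,k)$, where $\psi(k,j)=\binom{k-1}{2}+j-1$ for $k>j$ enumerates the pairs by $0,\dots,\binom n2-1$. *)

theory Defs
  imports Complex_Main "HOL-Library.FuncSet" "HOL-Library.Ramsey"
    "HOL-Computational_Algebra.Polynomial"
begin

section \<open>Finite simple graphs\<close>

record 'a ugraph =
  verts :: "'a set"
  edges :: "'a set set"

definition simple_graph :: "'a ugraph \<Rightarrow> bool" where
  "simple_graph G \<longleftrightarrow> finite (verts G) \<and> edges G \<subseteq> nsets (verts G) 2"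

definition complete_graph :: "nat \<Rightarrow> nat ugraph" where
  "complete_graph n = \<lparr>verts = {1..n}, edges = nsets {1..n} 2\<rparr>"

definition remove_edge :: "'a ugraph \<Rightarrow> 'a set \<Rightarrow> 'a ugraph" where
  "remove_edge G e = G\<lparr>edges := edges G - {e}\<rparr>"

definition graph_iso :: "'a ugraph \<Rightarrow> 'b ugraph \<Rightarrow> bool" where
  "graph_iso G H \<longleftrightarrow> (\<exists>f. bij_betw f (verts G) (verts H) \<and>
     (\<forall>u\<in>verts G. \<forall>v\<in>verts G. {u, v} \<in> edges G \<longleftrightarrow> {f u, f v} \<in> edges H))"

definition induced_subgraph :: "'a ugraph \<Rightarrow> 'a set \<Rightarrow> 'a ugraph" where
  "induced_subgraph G S = \<lparr>verts = S, edges = {e \<in> edges G. e \<subseteq> S}\<rparr>"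

definition connected_in :: "'a ugraph \<Rightarrow> ('a \<times> 'a) set" where
  "connected_in G =
     {(u, v). u \<in> verts G \<and> v \<in> verts G \<and> (u, v) \<in> {(a, b). {a, b} \<in> edges G}\<^sup>*}"

definition connected_components :: "'a ugraph \<Rightarrow> 'a ugraph set" where
  "connected_components G = induced_subgraph G ` (verts G // connected_in G)"

definition local_irregular_labeling :: "'a ugraph \<Rightarrow> nat \<Rightarrow> ('a set \<Rightarrow> nat) \<Rightarrow> bool" where
  "local_irregular_labeling G k l \<longleftrightarrow> l \<in> edges G \<rightarrow> {1..k} \<and>
     (\<forall>u v. {u, v} \<in> edges G \<longrightarrow>
        (\<Sum>e | e \<in> edges G \<and> u \<in> e. l e) \<noteq> (\<Sum>e | e \<in> edges G \<and> v \<in> e. l e))"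


section \<open>Weighted complete graphs\<close>

text \<open>
  The weight function is meant to have the set of 2-element subsets of the vertex set as its
  domain. Every operation below therefore restricts its result to that set (with the value
  \<^term>\<open>undefined\<close> elsewhere), so that equality of records is equality of weighted complete graphs.
\<close>

record ('a, 'r) wgraph =
  wverts :: "'a set"
  weight :: "'a set \<Rightarrow> 'r"

definition wgraph_of :: "'a ugraph \<Rightarrow> ('a, 'r::comm_ring_1) wgraph" where
  "wgraph_of G = \<lparr>wverts = verts G,
     weight = (\<lambda>e\<in>nsets (verts G) 2. if e \<in> edges G then 1 else 0)\<rparr>"

definition star_by ::
  "('a, 'r::comm_ring_1) wgraph \<Rightarrow> ('a \<Rightarrow> 'b) \<Rightarrow> ('b, 'r) wgraph \<Rightarrow> ('a, 'r) wgraph" where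
  "star_by H f G = \<lparr>wverts = wverts H,
     weight = (\<lambda>e\<in>nsets (wverts H) 2. weight H e * weight G (f ` e))\<rparr>"

definition star ::
  "('a, 'r::comm_ring_1) wgraph \<Rightarrow> ('b, 'r) wgraph \<Rightarrow> ('a, 'r) wgraph set" where
  "star H G = {star_by H f G | f. bij_betw f (wverts H) (wverts G)}"

definition star_set ::
  "('a, 'r::comm_ring_1) wgraph set \<Rightarrow> ('b, 'r) wgraph set \<Rightarrow> ('a, 'r) wgraph set"
  (infixl "\<star>" 70) where
  "\<H> \<star> \<G> = (\<Union>H\<in>\<H>. \<Union>G\<in>\<G>. star H G)"

text \<open>The power is meaningful for \<open>m \<ge> 1\<close> only.\<close>

definition star_power :: "('a, 'r::comm_ring_1) wgraph set \<Rightarrow> nat \<Rightarrow> ('a, 'r) wgraph set" where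
  "star_power \<G> m = ((\<lambda>\<X>. \<X> \<star> \<G>) ^^ (m - 1)) \<G>"

text \<open>Unspecified if the sequence of powers does not become constant.\<close>

definition star_infinity :: "('a, 'r::comm_ring_1) wgraph set \<Rightarrow> ('a, 'r) wgraph set" where
  "star_infinity \<G> =
     (THE \<X>. \<exists>m\<^sub>0\<ge>1. \<X> = star_power \<G> m\<^sub>0 \<and> (\<forall>m\<ge>m\<^sub>0. star_power \<G> m = star_power \<G> m\<^sub>0))"

definition weight_sum :: "('a, 'r::comm_ring_1) wgraph \<Rightarrow> 'r" where
  "weight_sum G = (\<Sum>e\<in>nsets (wverts G) 2. weight G e)"

text \<open>Addition is only used for weighted complete graphs on the same vertex set.\<close>

definition wgraph_plus ::
  "('a, 'r::comm_ring_1) wgraph \<Rightarrow> ('a, 'r) wgraph \<Rightarrow> ('a, 'r) wgraph" where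
  "wgraph_plus H\<^sub>1 H\<^sub>2 = \<lparr>wverts = wverts H\<^sub>1,
     weight = (\<lambda>e\<in>nsets (wverts H\<^sub>1) 2. weight H\<^sub>1 e + weight H\<^sub>2 e)\<rparr>"

definition wgraph_set_plus ::
  "('a, 'r::comm_ring_1) wgraph set \<Rightarrow> ('a, 'r) wgraph set \<Rightarrow> ('a, 'r) wgraph set" where
  "wgraph_set_plus \<H>\<^sub>1 \<H>\<^sub>2 = {wgraph_plus H\<^sub>1 H\<^sub>2 | H\<^sub>1 H\<^sub>2. H\<^sub>1 \<in> \<H>\<^sub>1 \<and> H\<^sub>2 \<in> \<H>\<^sub>2}"

text \<open>
  \<open>C_upto e k n\<close> is $C(1,\dots,k)_n$ for \<open>k \<ge> 1\<close>, formed with the removed edge \<open>e\<close> of the complete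
  graph on \<open>{1..n}\<close>: \<open>k - 1\<close> equal summands are added to the singleton of $I(K_n)$.
\<close>

definition C_upto :: "nat set \<Rightarrow> nat \<Rightarrow> nat \<Rightarrow> (nat, 'r::comm_ring_1) wgraph set" where
  "C_upto e k n =
     (wgraph_set_plus (star_infinity {wgraph_of (remove_edge (complete_graph n) e)}
                       \<union> {wgraph_of (complete_graph n)}) ^^ (k - 1))
       {wgraph_of (complete_graph n)}"

definition J :: "nat \<Rightarrow> nat \<Rightarrow> nat \<Rightarrow> (nat, complex) wgraph" where
  "J n j k = \<lparr>wverts = {1..n},
     weight = (\<lambda>e\<in>nsets {1..n} 2.
       if e = {j, k} then \<i>
       else if {j, k} \<inter> e = {j} then 1
       else if {j, k} \<inter> e = {k} then - 1
       else 0)\<rparr>"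

definition psi :: "nat \<Rightarrow> nat \<Rightarrow> nat" where
  "psi k j = ((k - 1) choose 2) + j - 1"

text \<open>The complex weights of \<open>J n j k\<close> are regarded as constant polynomials.\<close>

definition M :: "nat \<Rightarrow> (nat, complex poly) wgraph" where
  "M n = \<lparr>wverts = {1..n},
     weight = (\<lambda>e\<in>nsets {1..n} 2.
       \<Sum>(j, k) | 1 \<le> j \<and> j < k \<and> k \<le> n. monom 1 (psi k j) * [:weight (J n j k) e:])\<rparr>"

end

theory Submission
  imports Defs
begin

text \<open>
  The polynomials in question are an encoding of labelings, and the two graph classes differ only by
  isolated vertices.

  Repeated products of $K_n \setminus e$ delete further arbitrary edges but never restore \<open>e\<close>.
  So $K_n \setminus e$ generates every graph on $n$ vertices in which \<open>e\<close> is absent, and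
  $C(1,\dots,k)_n$ is the set of all labelings of $K_n$ by $\{1,\dots,k\}$ whose minimum is attained
  at \<open>e\<close> (\<open>C_upto_eq\<close>). The restriction disappears in the product with $I(G)$: a labeling of \<open>G\<close>
  extended by 1 to the non-edges has its minimum somewhere, and the product ranges over all
  bijections, one of which sends that place to \<open>e\<close>. Thus $I(G) * C(1,\dots,k)_n$ consists of all
  labelings of \<open>G\<close> by $\{1,\dots,k\}$, with weight 0 on the non-edges (\<open>wgraph_of_star_C_upto\<close>).

  Fix a labeling $l$ and a bijection onto $\{1,\dots,n\}$. The graphs $J(j,k)$ enter $M[x]$ with
  distinct powers of $x$, so every coefficient of the resulting polynomial belongs to one pair
  of vertices $u, v$, or vanishes. For the pair $u, v$ it is $\sigma(u) - \sigma(v) + i\, l(uv)$, where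
  $\sigma$ is the sum of the labels at a vertex: the label of $uv$ itself contributes to both sums
  and cancels (\<open>sum_labels_times_J\<close>). Labels of edges are positive and non-edges weigh 0, so a
  coefficient is nonzero and purely imaginary exactly when $uv$ is an edge with
  $\sigma(u) = \sigma(v)$. Hence, for one graph on at least two vertices, a polynomial without such
  coefficients exists if and only if a local irregular labeling does
  (\<open>local_irregular_labeling_iff_polynomial\<close>).

  It remains to compare the hypotheses on \<open>G\<close>. Deleting isolated vertices does not affect
  labelings, and the components that survive have an edge; such a component has order 2 only
  if it is a copy of $K_2$ (\<open>drop_isolated_component_card\<close>).
\<close>

section \<open>Moving edges by bijections\<close>

lemma ex_bij_betw_image_nsets:
  assumes "finite A" "finite B" "card A = card B" "S \<in> nsets A k" "T \<in> nsets B k"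
  obtains f where "bij_betw f A B" "f ` S = T"
proof -
  have S: "S \<subseteq> A" "finite S" "card S = k" and T: "T \<subseteq> B" "finite T" "card T = k"
    using assms by (auto simp: nsets_def)
  obtain f where f: "bij_betw f S T"
    using S T finite_same_card_bij by metis
  have "card (A - S) = card (B - T)"
    using S T assms by (simp add: card_Diff_subset)
  then obtain g where g: "bij_betw g (A - S) (B - T)"
    using assms finite_same_card_bij by (metis finite_Diff)
  let ?h = "\<lambda>x. if x \<in> S then f x else g x"
  have "bij_betw ?h (S \<union> (A - S)) (T \<union> (B - T))"
    using f g by (intro bij_betw_disjoint_Un) auto
  moreover have "S \<union> (A - S) = A" "T \<union> (B - T) = B"
    using S T by auto
  moreover have "?h ` S = T"
    using f by (auto simp: bij_betw_def)
  ultimately show thesis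
    using that by metis
qed

lemma bij_betw_image_nsets:
  assumes "bij_betw f A B" "x \<in> nsets A k"
  shows "f ` x \<in> nsets B k"
  using assms bij_betw_nsets bij_betwE by blast

lemma inj_image_eq_nsets:
  assumes "bij_betw f A B" "x \<in> nsets A k" "y \<in> nsets A k" "f ` x = f ` y"
  shows "x = y"
  using assms inj_on_image_eq_iff[of f A x y] by (simp add: bij_betw_def nsets_def)

section \<open>The factor C(1, ..., k)\<close>

text \<open>
  All weighted graphs on the way to $C(1,\dots,k)_n$ and to the labelings of \<open>G\<close> have natural
  numbers as weights. Keeping these as a function to \<^typ>\<open>nat\<close> reduces products and sums of weighted
  graphs to pointwise arithmetic there and makes the order of the labels available, which the
  ring of weights lacks.
\<close>

definition edge_weighted :: "'a set \<Rightarrow> ('a set \<Rightarrow> nat) \<Rightarrow> ('a, 'r::comm_ring_1) wgraph" where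
  "edge_weighted V l = \<lparr>wverts = V, weight = (\<lambda>x\<in>nsets V 2. of_nat (l x))\<rparr>"

lemma wverts_edge_weighted [simp]: "wverts (edge_weighted V l) = V"
  by (simp add: edge_weighted_def)

lemma wverts_wgraph_of [simp]: "wverts (wgraph_of G) = verts G"
  by (simp add: wgraph_of_def)

lemma star_setI:
  assumes "H \<in> \<H>" "K \<in> \<G>" "bij_betw f (wverts H) (wverts K)"
  shows "star_by H f K \<in> \<H> \<star> \<G>"
  using assms unfolding star_set_def star_def by blast

lemma star_set_singleton: "{h l | l. l \<in> L} \<star> {K} = (\<Union>l\<in>L. star (h l) K)"
  unfolding star_set_def by blast

lemma edge_weighted_cong:
  "(\<And>x. x \<in> nsets V 2 \<Longrightarrow> l x = m x) \<Longrightarrow> edge_weighted V l = edge_weighted V m"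
  by (simp add: edge_weighted_def cong: restrict_cong)

lemma wgraph_of_eq_edge_weighted:
  "wgraph_of G = edge_weighted (verts G) (\<lambda>x. if x \<in> edges G then 1 else 0)"
  by (auto simp: wgraph_of_def edge_weighted_def fun_eq_iff)

lemma star_by_edge_weighted:
  assumes "bij_betw f V W"
  shows "star_by (edge_weighted V l) f (edge_weighted W m) = edge_weighted V (\<lambda>x. l x * m (f ` x))"
  using bij_betw_image_nsets[OF assms]
  by (auto simp: star_by_def edge_weighted_def fun_eq_iff)

lemma wgraph_plus_edge_weighted:
  "wgraph_plus (edge_weighted V l) (edge_weighted V m) = edge_weighted V (\<lambda>x. l x + m x)"
  by (auto simp: wgraph_plus_def edge_weighted_def fun_eq_iff)

abbreviation without :: "'a set \<Rightarrow> 'a set set \<Rightarrow> ('a, 'r::comm_ring_1) wgraph" where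
  "without V F \<equiv> edge_weighted V (\<lambda>x. if x \<in> F then 0 else 1)"

lemma wgraph_of_complete_graph: "wgraph_of (complete_graph n) = edge_weighted {1..n} (\<lambda>_. 1)"
  unfolding wgraph_of_eq_edge_weighted
  by (auto simp: complete_graph_def intro!: edge_weighted_cong)

lemma wgraph_of_complete_graph_remove_edge:
  "wgraph_of (remove_edge (complete_graph n) e) = without {1..n} {e}"
  unfolding wgraph_of_eq_edge_weighted
  by (auto simp: complete_graph_def remove_edge_def intro!: edge_weighted_cong)

text \<open>
  A bijection pulls the missing edge \<open>e\<close> of the second factor back to a pair \<open>x\<close>, and since
  bijections act transitively on pairs, \<open>x\<close> is arbitrary.
\<close>

lemma star_without:
  assumes V: "finite V" and e: "e \<in> nsets V 2"
  shows "star (without V F :: ('a, 'r::comm_ring_1) wgraph) (without V {e})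
    = {without V (insert x F) | x. x \<in> nsets V 2}"
    (is "?L = ?R")
proof -
  have eq: "star_by (without V F) f (without V {e}) = (without V (insert x F) :: ('a, 'r) wgraph)"
    if f: "bij_betw f V V" "f ` x = e" "x \<in> nsets V 2" for f x
    unfolding star_by_edge_weighted[OF f(1)]
    using f inj_image_eq_nsets[OF f(1)] by (intro edge_weighted_cong) auto
  show ?thesis
  proof (intro equalityI subsetI)
    fix H assume "H \<in> ?L"
    then obtain f where f: "bij_betw f V V" and H: "H = star_by (without V F) f (without V {e})"
      by (auto simp: star_def)
    obtain x where "x \<in> nsets V 2" "f ` x = e"
      using bij_betw_nsets[OF f, of 2] e by (metis bij_betw_imp_surj_on imageE)
    then show "H \<in> ?R"
      using eq f H by blast
  next
    fix H assume "H \<in> ?R"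
    then obtain x where x: "x \<in> nsets V 2" and H: "H = without V (insert x F)"
      by blast
    obtain f where f: "bij_betw f V V" "f ` x = e"
      using ex_bij_betw_image_nsets[OF V V refl x e] .
    show "H \<in> ?L"
      unfolding star_def using f(1) eq[OF f x]
      unfolding H by (intro CollectI exI[of _ f] conjI) simp_all
  qed
qed

text \<open>
  The first factor is never permuted, so \<open>e\<close> itself is missing from every power; each further
  factor removes one arbitrary pair, which may have been removed before.
\<close>

lemma star_power_without:
  assumes V: "finite V" and e: "e \<in> nsets V 2"
  shows "star_power {without V {e} :: ('a, 'r::comm_ring_1) wgraph} (Suc m)
    = {without V F | F. F \<subseteq> nsets V 2 \<and> e \<in> F \<and> card F \<le> Suc m}"
proof -
  have fin: "finite F" if "F \<subseteq> nsets V 2" for F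
    using that finite_imp_finite_nsets[OF V] by (rule finite_subset)
  show ?thesis
  proof (induction m)
    case 0
    have "F = {e}" if "F \<subseteq> nsets V 2" "e \<in> F" "card F \<le> Suc 0" for F
      using that card_le_Suc0_iff_eq[OF fin[OF that(1)]] by blast
    then have "F \<subseteq> nsets V 2 \<and> e \<in> F \<and> card F \<le> Suc 0 \<longleftrightarrow> F = {e}" for F
      using e by (intro iffI) (blast, simp)
    then show ?case
      by (simp add: star_power_def)
  next
    case (Suc m)
    have "star_power {without V {e}} (Suc (Suc m))
        = star_power {without V {e}} (Suc m) \<star> {without V {e} :: ('a, 'r) wgraph}"
      by (simp add: star_power_def)
    also have "\<dots> = (\<Union>F\<in>{F. F \<subseteq> nsets V 2 \<and> e \<in> F \<and> card F \<le> Suc m}.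
        star (without V F) (without V {e}))"
      unfolding Suc.IH star_set_def by blast
    also have "\<dots> = {without V (insert x F) | x F.
        x \<in> nsets V 2 \<and> F \<subseteq> nsets V 2 \<and> e \<in> F \<and> card F \<le> Suc m}"
      unfolding star_without[OF V e] by blast
    also have "\<dots> = {without V F | F. F \<subseteq> nsets V 2 \<and> e \<in> F \<and> card F \<le> Suc (Suc m)}"
    proof (intro equalityI subsetI)
      fix H :: "('a, 'r) wgraph"
      assume "H \<in> {without V (insert x F) | x F.
        x \<in> nsets V 2 \<and> F \<subseteq> nsets V 2 \<and> e \<in> F \<and> card F \<le> Suc m}"
      then obtain x F where "x \<in> nsets V 2" "F \<subseteq> nsets V 2" "e \<in> F" "card F \<le> Suc m"
        and H: "H = without V (insert x F)"
        by blast
      then have "insert x F \<subseteq> nsets V 2 \<and> e \<in> insert x F \<and> card (insert x F) \<le> Suc (Suc m)"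
        using fin by (auto simp: card_insert_if)
      then show "H \<in> {without V F | F. F \<subseteq> nsets V 2 \<and> e \<in> F \<and> card F \<le> Suc (Suc m)}"
        using H by blast
    next
      fix H :: "('a, 'r) wgraph"
      assume "H \<in> {without V F | F. F \<subseteq> nsets V 2 \<and> e \<in> F \<and> card F \<le> Suc (Suc m)}"
      then obtain F where F: "F \<subseteq> nsets V 2" "e \<in> F" "card F \<le> Suc (Suc m)"
        and H: "H = without V F"
        by blast
      have "\<exists>x F'. F = insert x F' \<and> x \<in> nsets V 2 \<and> F' \<subseteq> nsets V 2 \<and> e \<in> F' \<and> card F' \<le> Suc m"
      proof (cases "F = {e}")
        case True
        then show ?thesis
          using e by (intro exI[of _ e] exI[of _ F]) auto
      next
        case False
        then obtain x where x: "x \<in> F" "x \<noteq> e"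
          using F by blast
        then show ?thesis
          using F fin[OF F(1)] by (intro exI[of _ x] exI[of _ "F - {x}"]) auto
      qed
      then show "H \<in> {without V (insert x F) | x F.
        x \<in> nsets V 2 \<and> F \<subseteq> nsets V 2 \<and> e \<in> F \<and> card F \<le> Suc m}"
        unfolding H by blast
    qed
    finally show ?case .
  qed
qed

lemma star_infinity_eq:
  assumes "m\<^sub>0 \<ge> 1" and const: "\<And>m. m \<ge> m\<^sub>0 \<Longrightarrow> star_power \<G> m = \<X>"
  shows "star_infinity \<G> = \<X>"
  unfolding star_infinity_def
proof (rule the_equality)
  show "\<exists>m\<^sub>0\<ge>1. \<X> = star_power \<G> m\<^sub>0 \<and> (\<forall>m\<ge>m\<^sub>0. star_power \<G> m = star_power \<G> m\<^sub>0)"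
    using assms by (metis order_refl)
next
  fix \<Y>
  assume "\<exists>m\<^sub>0\<ge>1. \<Y> = star_power \<G> m\<^sub>0 \<and> (\<forall>m\<ge>m\<^sub>0. star_power \<G> m = star_power \<G> m\<^sub>0)"
  then show "\<Y> = \<X>"
    using const by (metis max.cobounded1 max.cobounded2)
qed

lemma star_infinity_without:
  assumes V: "finite V" and e: "e \<in> nsets V 2"
  shows "star_infinity {without V {e}} = {without V F | F. F \<subseteq> nsets V 2 \<and> e \<in> F}"
proof (rule star_infinity_eq)
  fix m assume m: "Suc (card (nsets V 2)) \<le> m"
  then obtain m' where m': "m = Suc m'"
    using Suc_le_D by blast
  have "card F \<le> m" if "F \<subseteq> nsets V 2" for F
    using card_mono[OF finite_imp_finite_nsets[OF V] that] m by simp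
  then show "star_power {without V {e}} m = {without V F | F. F \<subseteq> nsets V 2 \<and> e \<in> F}"
    unfolding m' star_power_without[OF assms]
    by (intro Collect_cong ex_cong1) auto
qed simp

text \<open>
  Each summand of $C(1,\dots,k)_n$ either is 0 at \<open>e\<close> and arbitrary in $\{0,1\}$ elsewhere, or is
  constantly 1; both increase the value at \<open>e\<close> by no more than the value at any other pair, so \<open>e\<close>
  keeps the minimum. Conversely, the top value is peeled off: the indicator of the pairs labelled
  $k+1$ is an admissible summand, because it contains \<open>e\<close> only if the labeling is constant.
\<close>

lemma C_upto_eq:
  assumes e: "e \<in> nsets {1..n} 2" and k: "k \<ge> 1"
  shows "(C_upto e k n :: (nat, 'r::comm_ring_1) wgraph set)
    = {edge_weighted {1..n} l | l. l \<in> nsets {1..n} 2 \<rightarrow> {1..k} \<and> (\<forall>x\<in>nsets {1..n} 2. l e \<le> l x)}"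
  using k
proof (induction k rule: dec_induct)
  case base
  have "edge_weighted {1..n} l = edge_weighted {1..n} (\<lambda>_. 1)" if "l \<in> nsets {1..n} 2 \<rightarrow> {1..1}" for l
    using that by (intro edge_weighted_cong) fastforce
  then show ?case
    unfolding C_upto_def wgraph_of_complete_graph
    by (auto intro!: exI[of _ "\<lambda>_. 1"])
next
  case (step k)
  let ?N = "nsets {1..n} 2"
  let ?A = "star_infinity {wgraph_of (remove_edge (complete_graph n) e)}
      \<union> {wgraph_of (complete_graph n) :: (nat, 'r) wgraph}"
  have A: "?A = {without {1..n} F | F. F \<subseteq> ?N \<and> (e \<in> F \<or> F = {})}"
  proof -
    have complete: "wgraph_of (complete_graph n) = (without {1..n} {} :: (nat, 'r) wgraph)"
      by (simp add: wgraph_of_complete_graph)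
    have split: "{f F | F. F \<subseteq> ?N \<and> e \<in> F} \<union> {f {}} = {f F | F. F \<subseteq> ?N \<and> (e \<in> F \<or> F = {})}"
      for f :: "nat set set \<Rightarrow> (nat, 'r) wgraph"
      by blast
    show ?thesis
      unfolding wgraph_of_complete_graph_remove_edge star_infinity_without[OF finite_atLeastAtMost e]
        complete
      by (rule split)
  qed
  have k: "Suc k - 1 = Suc (k - 1)"
    using step.hyps by simp
  have "(C_upto e (Suc k) n :: (nat, 'r) wgraph set) = wgraph_set_plus ?A (C_upto e k n)"
    unfolding C_upto_def k by simp
  also have "\<dots> = {edge_weighted {1..n} (\<lambda>x. (if x \<in> F then 0 else 1) + l x) | F l.
      F \<subseteq> ?N \<and> (e \<in> F \<or> F = {}) \<and> l \<in> ?N \<rightarrow> {1..k} \<and> (\<forall>x\<in>?N. l e \<le> l x)}"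
    unfolding step.IH A wgraph_set_plus_def wgraph_plus_edge_weighted[symmetric] by blast
  also have "\<dots> = {edge_weighted {1..n} l | l. l \<in> ?N \<rightarrow> {1..Suc k} \<and> (\<forall>x\<in>?N. l e \<le> l x)}"
    (is "?L = ?R")
  proof (intro equalityI subsetI)
    fix H assume "H \<in> ?L"
    then obtain F l where Fl: "F \<subseteq> ?N" "e \<in> F \<or> F = {}" "l \<in> ?N \<rightarrow> {1..k}" "\<forall>x\<in>?N. l e \<le> l x"
      and H: "H = edge_weighted {1..n} (\<lambda>x. (if x \<in> F then 0 else 1) + l x)"
      by blast
    let ?m = "\<lambda>x. (if x \<in> F then 0 else 1) + l x"
    have "?m x \<in> {1..Suc k} \<and> ?m e \<le> ?m x" if "x \<in> ?N" for x
      using Fl(2) funcset_mem[OF Fl(3) that] bspec[OF Fl(4) that] by auto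
    then show "H \<in> ?R"
      unfolding H by (intro CollectI exI[of _ ?m]) blast
  next
    fix H assume "H \<in> ?R"
    then obtain l where l: "l \<in> ?N \<rightarrow> {1..Suc k}" "\<forall>x\<in>?N. l e \<le> l x"
      and H: "H = edge_weighted {1..n} l"
      by blast
    \<comment> \<open>The summand split off is 0 on \<open>F\<close> and 1 on the pairs with the top label.\<close>
    define F where "F = {x \<in> ?N. l x \<le> k}"
    have "F \<subseteq> ?N" "e \<in> F \<or> F = {}"
      using e l(2) by (auto simp: F_def intro: order_trans)
    have "(\<lambda>x. min (l x) k) \<in> ?N \<rightarrow> {1..k}"
      using l(1) step.hyps by (auto simp: Pi_iff)
    have "\<forall>x\<in>?N. min (l e) k \<le> min (l x) k"
      using l(2) by (auto simp: min_def intro: order_trans)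
    have "H = edge_weighted {1..n} (\<lambda>x. (if x \<in> F then 0 else 1) + min (l x) k)"
      unfolding H
    proof (rule edge_weighted_cong)
      fix x assume x: "x \<in> ?N"
      then have "l x \<le> Suc k"
        using l(1) by auto
      then show "l x = (if x \<in> F then 0 else 1) + min (l x) k"
        using x by (auto simp: F_def)
    qed
    show "H \<in> ?L"
      by (rule CollectI, intro exI[of _ F] exI[of _ "\<lambda>x. min (l x) k"] conjI) fact+
  qed
  finally show ?case .
qed

section \<open>Labelings of a graph as a product\<close>

definition labelled :: "'a ugraph \<Rightarrow> ('a set \<Rightarrow> nat) \<Rightarrow> ('a, 'r::comm_ring_1) wgraph" where
  "labelled G l = edge_weighted (verts G) (\<lambda>x. if x \<in> edges G then l x else 0)"

text \<open>
  The preferred position of \<open>e\<close> in $C(1,\dots,k)_n$ is no restriction, since a bijection can send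
  the place of the minimal label to \<open>e\<close>. At least two vertices are needed for such a place to exist.
\<close>

lemma wgraph_of_star_C_upto:
  assumes G: "simple_graph G" and n: "n = card (verts G)" "n \<ge> 2"
    and e: "e \<in> nsets {1..n} 2" and k: "k \<ge> 1"
  shows "{wgraph_of G} \<star> C_upto e k n = {labelled G l | l. l \<in> edges G \<rightarrow> {1..k}}" (is "?L = ?R")
proof (intro equalityI subsetI)
  fix H assume "H \<in> ?L"
  then obtain f l where f: "bij_betw f (verts G) {1..n}" and l: "l \<in> nsets {1..n} 2 \<rightarrow> {1..k}"
    and H: "H = star_by (wgraph_of G) f (edge_weighted {1..n} l)"
    by (auto simp: star_set_def star_def C_upto_eq[OF e k] wgraph_of_def)
  have "H = labelled G (\<lambda>x. l (f ` x))"
    unfolding H labelled_def wgraph_of_eq_edge_weighted star_by_edge_weighted[OF f]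
    by (auto intro!: edge_weighted_cong)
  moreover have "(\<lambda>x. l (f ` x)) \<in> edges G \<rightarrow> {1..k}"
    using l bij_betw_image_nsets[OF f] G by (force simp: simple_graph_def Pi_iff)
  ultimately show "H \<in> ?R"
    by blast
next
  fix H assume "H \<in> ?R"
  then obtain l where l: "l \<in> edges G \<rightarrow> {1..k}" and H: "H = labelled G l"
    by blast
  let ?N = "nsets (verts G) 2"
  have fin: "finite (verts G)"
    using G by (simp add: simple_graph_def)
  define l' where "l' x = (if x \<in> edges G then l x else 1)" for x
  have l': "l' x \<in> {1..k}" for x
    using l k by (auto simp: l'_def)
  have "?N \<noteq> {}"
    using n fin by (simp add: nsets_eq_empty_iff)
  then obtain x\<^sub>0 where x\<^sub>0: "x\<^sub>0 \<in> ?N" "\<And>x. x \<in> ?N \<Longrightarrow> l' x\<^sub>0 \<le> l' x"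
    using ex_has_least_nat[of "\<lambda>x. x \<in> ?N" _ l'] by blast
  obtain f where f: "bij_betw f (verts G) {1..n}" "f ` x\<^sub>0 = e"
    using ex_bij_betw_image_nsets[OF fin finite_atLeastAtMost _ x\<^sub>0(1) e] n(1)
    by (metis card_atLeastAtMost diff_Suc_1)
  define g where "g = inv_into (verts G) f"
  have g: "bij_betw g {1..n} (verts G)"
    unfolding g_def using f(1) by (rule bij_betw_inv_into)
  have gf: "g ` f ` x = x" if "x \<in> ?N" for x
    using that f(1) unfolding g_def nsets_def bij_betw_def
    by (auto simp: inv_into_image_cancel)
  have "edge_weighted {1..n} (\<lambda>x. l' (g ` x)) \<in> C_upto e k n"
    unfolding C_upto_eq[OF e k]
    using l' x\<^sub>0 f(2) gf[OF x\<^sub>0(1)] bij_betw_image_nsets[OF g]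
    by (intro CollectI exI conjI refl) auto
  moreover have "H = star_by (wgraph_of G) f (edge_weighted {1..n} (\<lambda>x. l' (g ` x)))"
    unfolding H labelled_def wgraph_of_eq_edge_weighted star_by_edge_weighted[OF f(1)]
    using gf by (auto intro!: edge_weighted_cong simp: l'_def)
  ultimately show "H \<in> ?L"
    using f(1) by (simp only:) (rule star_setI, simp_all)
qed

section \<open>Coefficients of the product with M[x]\<close>

text \<open>
  The exponents belonging to a fixed larger endpoint $k$ fill the interval from $\binom{k-1}{2}$ to
  $\binom{k}{2}-1$, and these intervals are disjoint for different $k$.
\<close>

lemma psi_less:
  assumes "1 \<le> j" "j < k" "1 \<le> j'" "k < k'"
  shows "psi k j < psi k' j'"
proof -
  obtain m where k: "k = Suc m"
    using assms by (cases k) auto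
  have "psi k j < (m choose 2) + m"
    using assms by (simp add: psi_def k)
  also have "\<dots> = Suc m choose 2"
    by (simp add: numeral_2_eq_2)
  also have "\<dots> \<le> (k' - 1) choose 2"
    using assms k by (intro binomial_right_mono) auto
  also have "\<dots> \<le> psi k' j'"
    using assms by (simp add: psi_def)
  finally show ?thesis .
qed

lemma psi_inject:
  assumes "1 \<le> j" "j < k" "1 \<le> j'" "j' < k'" "psi k j = psi k' j'"
  shows "j = j' \<and> k = k'"
proof -
  have "k = k'"
    using psi_less assms by (metis less_irrefl linorder_neqE_nat)
  then show ?thesis
    using assms by (simp add: psi_def)
qed

definition incident_sum :: "'a ugraph \<Rightarrow> ('a set \<Rightarrow> nat) \<Rightarrow> 'a \<Rightarrow> nat" where
  "incident_sum G l u = (\<Sum>x | x \<in> edges G \<and> u \<in> x. l x)"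

text \<open>
  The real part is $[u \in x] - [v \in x]$, also at the pair $uv$ itself, where it is 0. Sums against
  it are therefore differences of incident sums.
\<close>

lemma weight_J_image:
  assumes g: "bij_betw g V {1..n}" and uv: "u \<in> V" "v \<in> V" "u \<noteq> v" and x: "x \<in> nsets V 2"
  shows "weight (J n (g u) (g v)) (g ` x)
    = (if x = {u, v} then \<i> else 0) + of_bool (u \<in> x) - of_bool (v \<in> x)"
proof -
  obtain a b where ab: "x = {a, b}" "a \<noteq> b" "a \<in> V" "b \<in> V"
    using x by (auto simp: nsets_2_eq)
  have "\<And>p q. p \<in> V \<Longrightarrow> q \<in> V \<Longrightarrow> g p = g q \<longleftrightarrow> p = q"
    using g by (meson bij_betw_def inj_on_eq_iff)
  then show ?thesis
    using bij_betw_image_nsets[OF g x] uv ab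
    by (auto simp: J_def doubleton_eq_iff)
qed

lemma sum_labels_times_J:
  assumes G: "simple_graph G" and g: "bij_betw g (verts G) {1..n}"
    and uv: "u \<in> verts G" "v \<in> verts G" "u \<noteq> v"
  shows "(\<Sum>x\<in>nsets (verts G) 2.
      of_nat (if x \<in> edges G then l x else 0) * weight (J n (g u) (g v)) (g ` x))
    = Complex (real (incident_sum G l u) - real (incident_sum G l v))
        (if {u, v} \<in> edges G then l {u, v} else 0)"
proof -
  let ?N = "nsets (verts G) 2"
  let ?w = "\<lambda>x. if x \<in> edges G then l x else 0"
  have fin: "finite ?N"
    using G by (simp add: simple_graph_def finite_imp_finite_nsets)
  have inc: "(\<Sum>x\<in>?N. of_nat (?w x) * of_bool (p \<in> x)) = (of_nat (incident_sum G l p) :: complex)" for p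
  proof -
    have "(\<Sum>x\<in>?N. of_nat (?w x) * of_bool (p \<in> x))
        = (\<Sum>x\<in>?N. if x \<in> edges G \<and> p \<in> x then of_nat (l x) else (0 :: complex))"
      by (intro sum.cong) auto
    also have "\<dots> = (\<Sum>x\<in>{x \<in> ?N. x \<in> edges G \<and> p \<in> x}. of_nat (l x))"
      using fin by (rule sum.inter_filter[symmetric])
    also have "{x \<in> ?N. x \<in> edges G \<and> p \<in> x} = {x. x \<in> edges G \<and> p \<in> x}"
      using G by (auto simp: simple_graph_def)
    finally show ?thesis
      by (simp add: incident_sum_def)
  qed
  have uv_N: "{u, v} \<in> ?N"
    using uv by (auto simp: nsets_2_eq)
  have "(\<Sum>x\<in>?N. of_nat (?w x) * (if x = {u, v} then \<i> else 0))
      = (\<Sum>x\<in>?N. if x = {u, v} then of_nat (?w {u, v}) * \<i> else 0)"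
    by (rule sum.cong[OF refl]) auto
  also have "\<dots> = of_nat (?w {u, v}) * \<i>"
    using fin uv_N by (simp only: sum.delta if_True)
  finally have uv_term: "(\<Sum>x\<in>?N. of_nat (?w x) * (if x = {u, v} then \<i> else 0))
      = of_nat (?w {u, v}) * \<i>" .
  have "(\<Sum>x\<in>?N. of_nat (?w x) * weight (J n (g u) (g v)) (g ` x))
      = (\<Sum>x\<in>?N. of_nat (?w x) * (if x = {u, v} then \<i> else 0)
          + of_nat (?w x) * of_bool (u \<in> x) - of_nat (?w x) * of_bool (v \<in> x))"
    by (intro sum.cong refl) (simp only: weight_J_image[OF g uv] algebra_simps)
  also have "\<dots> = of_nat (?w {u, v}) * \<i> + of_nat (incident_sum G l u) - of_nat (incident_sum G l v)"
    unfolding sum_subtractf sum.distrib inc uv_term ..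
  also have "\<dots> = Complex (real (incident_sum G l u) - real (incident_sum G l v)) (?w {u, v})"
    by (simp add: complex_eq_iff)
  finally show ?thesis .
qed

lemma coeff_weight_sum_star_M:
  assumes "bij_betw g V {1..n}"
  shows "coeff (weight_sum (star_by (edge_weighted V w) g (M n))) i
    = (\<Sum>(j, k) | 1 \<le> j \<and> j < k \<and> k \<le> n.
        if psi k j = i then \<Sum>x\<in>nsets V 2. of_nat (w x) * weight (J n j k) (g ` x) else 0)"
proof -
  let ?P = "{(j, k). 1 \<le> j \<and> j < k \<and> k \<le> n}"
  have "coeff (weight_sum (star_by (edge_weighted V w) g (M n))) i
      = (\<Sum>x\<in>nsets V 2. coeff (of_nat (w x) *
          (\<Sum>(j, k)\<in>?P. monom 1 (psi k j) * [:weight (J n j k) (g ` x):])) i)"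
    using bij_betw_image_nsets[OF assms]
    by (simp add: weight_sum_def star_by_def edge_weighted_def M_def coeff_sum)
  also have "\<dots> = (\<Sum>x\<in>nsets V 2. \<Sum>(j, k)\<in>?P.
      if psi k j = i then of_nat (w x) * weight (J n j k) (g ` x) else 0)"
    by (intro sum.cong refl)
      (auto simp: of_nat_poly coeff_sum sum_distrib_left split_beta mult.commute[of "monom _ _"]
        smult_monom intro!: sum.cong)
  also have "\<dots> = (\<Sum>(j, k)\<in>?P. \<Sum>x\<in>nsets V 2.
      if psi k j = i then of_nat (w x) * weight (J n j k) (g ` x) else 0)"
    unfolding split_beta by (rule sum.swap)
  finally show ?thesis
    by (auto intro!: sum.cong simp: if_distrib)
qed

lemma coeff_weight_sum_star_M_psi:
  assumes "bij_betw g V {1..n}" "1 \<le> j" "j < k" "k \<le> n"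
  shows "coeff (weight_sum (star_by (edge_weighted V w) g (M n))) (psi k j)
    = (\<Sum>x\<in>nsets V 2. of_nat (w x) * weight (J n j k) (g ` x))"
proof -
  let ?P = "{(j, k). 1 \<le> j \<and> j < k \<and> k \<le> n}"
  let ?s = "\<lambda>p. \<Sum>x\<in>nsets V 2. of_nat (w x) * weight (J n (fst p) (snd p)) (g ` x)"
  have fin: "finite ?P"
    by (rule finite_subset[of _ "{1..n} \<times> {1..n}"]) auto
  have "coeff (weight_sum (star_by (edge_weighted V w) g (M n))) (psi k j)
      = (\<Sum>p\<in>?P. if p = (j, k) then ?s p else 0)"
    unfolding coeff_weight_sum_star_M[OF assms(1)]
  proof (intro sum.cong refl)
    fix p assume "p \<in> ?P"
    then obtain j' k' where p: "p = (j', k')" "1 \<le> j'" "j' < k'"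
      by auto
    then have "psi k' j' = psi k j \<longleftrightarrow> p = (j, k)"
      using psi_inject[of j' k' j k] assms(2,3) by auto
    then show "(case p of (j', k') \<Rightarrow> if psi k' j' = psi k j
          then \<Sum>x\<in>nsets V 2. of_nat (w x) * weight (J n j' k') (g ` x) else 0)
        = (if p = (j, k) then ?s p else 0)"
      by (simp add: p(1))
  qed
  also have "\<dots> = ?s (j, k)"
    using fin assms by (simp add: sum.delta)
  finally show ?thesis
    by simp
qed

text \<open>
  The imaginary part of a coefficient is a positive label on edges and 0 on non-edges, and the real
  part is a difference of incident sums. A pair with equal incident sums therefore makes the
  coefficient purely imaginary if it is an edge, and 0 otherwise.
\<close>

lemma imaginary_coeff_iff:
  assumes G: "simple_graph G" and g: "bij_betw g (verts G) {1..n}" and l: "l \<in> edges G \<rightarrow> {1..k}"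
  defines "p \<equiv> weight_sum (star_by (labelled G l) g (M n))"
  shows "(\<exists>i. coeff p i \<noteq> 0 \<and> Re (coeff p i) = 0)
    \<longleftrightarrow> (\<exists>u v. {u, v} \<in> edges G \<and> incident_sum G l u = incident_sum G l v)" (is "?L \<longleftrightarrow> ?R")
proof -
  have c: "coeff p (psi (g v) (g u)) = Complex (real (incident_sum G l u) - real (incident_sum G l v))
        (if {u, v} \<in> edges G then l {u, v} else 0)"
    if uv: "u \<in> verts G" "v \<in> verts G" "g u < g v" for u v
  proof -
    have range: "1 \<le> g u" "g v \<le> n" and "u \<noteq> v"
      using g uv bij_betwE[OF g] by auto
    then show ?thesis
      unfolding p_def labelled_def coeff_weight_sum_star_M_psi[OF g range(1) uv(3) range(2)]
      by (intro sum_labels_times_J[OF G g uv(1,2)])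
  qed
  show ?thesis
  proof
    assume ?L
    then obtain i where i: "coeff p i \<noteq> 0" "Re (coeff p i) = 0"
      by blast
    obtain j m where jm: "1 \<le> j" "j < m" "m \<le> n" "psi m j = i"
    proof (rule ccontr)
      assume "\<not> thesis"
      then have "coeff p i = 0"
        unfolding p_def labelled_def coeff_weight_sum_star_M[OF g]
        using that by (intro sum.neutral) auto
      then show False
        using i by simp
    qed
    then have "j \<in> g ` verts G" "m \<in> g ` verts G"
      using g by (auto simp: bij_betw_def)
    then obtain u v where "u \<in> verts G" "v \<in> verts G" "j = g u" "m = g v"
      by blast
    then show ?R
      using c[of u v] jm i by (auto simp: complex_eq_iff split: if_splits)
  next
    assume ?R
    then obtain u v where e: "{u, v} \<in> edges G" and eq: "incident_sum G l u = incident_sum G l v"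
      by blast
    then have uv: "u \<in> verts G" "v \<in> verts G" "u \<noteq> v"
      using G by (auto simp: simple_graph_def nsets_2_eq doubleton_eq_iff)
    then have "g u \<noteq> g v"
      using g by (meson bij_betw_def inj_on_eq_iff)
    \<comment> \<open>The coefficient of an edge is indexed with the endpoint of smaller number first.\<close>
    moreover have ?L if "g a < g b" "{a, b} = {u, v}" for a b
    proof (intro exI conjI)
      have "a = u \<and> b = v \<or> a = v \<and> b = u"
        using that(2) by (simp add: doubleton_eq_iff)
      then have ab: "a \<in> verts G" "b \<in> verts G" "incident_sum G l a = incident_sum G l b"
        using uv eq by auto
      have ab_edge: "{a, b} \<in> edges G"
        using that(2) e by simp
      then have "l {a, b} \<ge> 1"
        using l by auto
      then show "coeff p (psi (g b) (g a)) \<noteq> 0" "Re (coeff p (psi (g b) (g a))) = 0"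
        using ab ab_edge by (simp_all add: c[OF ab(1,2) that(1)] complex_eq_iff)
    qed
    ultimately show ?L
      by (metis insert_commute linorder_neqE_nat)
  qed
qed

lemma local_irregular_labeling_iff_polynomial:
  assumes G: "simple_graph G" and n: "n = card (verts G)" "n \<ge> 2"
    and e: "e \<in> nsets {1..n} 2" and k: "k \<ge> 1"
  shows "(\<exists>l. local_irregular_labeling G k l)
    \<longleftrightarrow> (\<exists>p \<in> weight_sum ` ({wgraph_of G} \<star> C_upto e k n \<star> {M n}).
          \<not> (\<exists>i. coeff p i \<noteq> 0 \<and> Re (coeff p i) = 0))" (is "_ \<longleftrightarrow> ?R")
proof -
  have "finite (verts G)" "card (verts G) = card {1..n}"
    using G n(1) by (simp_all add: simple_graph_def)
  then have ex_bij: "\<exists>g. bij_betw g (verts G) {1..n}"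
    by (intro finite_same_card_bij finite_atLeastAtMost)
  let ?imaginary = "\<lambda>p. \<exists>i. coeff p i \<noteq> 0 \<and> Re (coeff p i) = 0"
  let ?L = "\<lambda>l. labelled G l :: ('a, complex poly) wgraph"
  have star: "star (?L l) (M n) = {star_by (?L l) g (M n) | g. bij_betw g (verts G) {1..n}}" for l
    by (simp add: star_def labelled_def M_def)
  have "{wgraph_of G} \<star> C_upto e k n \<star> {M n} = (\<Union>l\<in>edges G \<rightarrow> {1..k}. star (?L l) (M n))"
    unfolding wgraph_of_star_C_upto[OF assms] by (rule star_set_singleton)
  then have "?R \<longleftrightarrow> (\<exists>l g. l \<in> edges G \<rightarrow> {1..k} \<and> bij_betw g (verts G) {1..n} \<and>
      \<not> ?imaginary (weight_sum (star_by (?L l) g (M n))))"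
    unfolding star by (simp only: bex_simps UN_iff mem_Collect_eq) blast
  also have "\<dots> \<longleftrightarrow> (\<exists>l g. l \<in> edges G \<rightarrow> {1..k} \<and> bij_betw g (verts G) {1..n} \<and>
      \<not> (\<exists>u v. {u, v} \<in> edges G \<and> incident_sum G l u = incident_sum G l v))"
    by (intro ex_cong1 conj_cong refl arg_cong[of _ _ Not] imaginary_coeff_iff[OF G])
  also have "\<dots> \<longleftrightarrow> (\<exists>l g. bij_betw g (verts G) {1..n} \<and> local_irregular_labeling G k l)"
    unfolding local_irregular_labeling_def incident_sum_def by blast
  also have "\<dots> \<longleftrightarrow> (\<exists>l. local_irregular_labeling G k l)"
    using ex_bij by blast
  finally show ?thesis
    by simp
qed

section \<open>Isolated vertices\<close>

definition drop_isolated :: "'a ugraph \<Rightarrow> 'a ugraph" where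
  "drop_isolated G = G\<lparr>verts := \<Union>(edges G)\<rparr>"

lemma simple_graph_drop_isolated: "simple_graph G \<Longrightarrow> simple_graph (drop_isolated G)"
  unfolding simple_graph_def drop_isolated_def
  by (auto simp: nsets_def intro: finite_subset[of _ "verts G"])

lemma local_irregular_labeling_drop_isolated:
  "local_irregular_labeling (drop_isolated G) k l \<longleftrightarrow> local_irregular_labeling G k l"
  by (simp add: local_irregular_labeling_def drop_isolated_def)

lemma graph_iso_complete_graph_2_card: "graph_iso C (complete_graph 2) \<Longrightarrow> card (verts C) = 2"
  unfolding graph_iso_def complete_graph_def by (auto dest: bij_betw_same_card)

text \<open>
  The component of a non-isolated vertex \<open>u\<close> is the same before and after the deletion, because paths
  from \<open>u\<close> meet no isolated vertex. It contains an edge at \<open>u\<close>; if its order is less than 3, it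
  consists of the two ends of that edge and is a copy of $K_2$ in \<open>G\<close>.
\<close>

lemma drop_isolated_component_card:
  assumes G: "simple_graph G"
    and K2: "\<And>C. C \<in> connected_components G \<Longrightarrow> \<not> graph_iso C (complete_graph 2)"
    and C: "C \<in> connected_components (drop_isolated G)"
  shows "card (verts C) \<ge> 3"
proof (rule ccontr)
  assume "\<not> card (verts C) \<ge> 3"
  obtain u where u: "u \<in> \<Union>(edges G)"
    and C_def: "C = induced_subgraph (drop_isolated G) (connected_in (drop_isolated G) `` {u})"
    using C by (auto simp: connected_components_def quotient_def drop_isolated_def)
  let ?S = "connected_in G `` {u}"
  have uV: "u \<in> verts G" and finV: "finite (verts G)"
    using u G by (auto simp: simple_graph_def nsets_def)
  have "b \<in> \<Union>(edges G)" if "(a, b) \<in> {(a, b). {a, b} \<in> edges G}\<^sup>*" "a \<in> \<Union>(edges G)" for a b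
    using that by (induction rule: rtrancl_induct) auto
  then have S: "connected_in (drop_isolated G) `` {u} = ?S"
    using u G by (auto simp: connected_in_def drop_isolated_def simple_graph_def nsets_def)
  have C_eq: "C = induced_subgraph G ?S"
    unfolding C_def S by (simp add: induced_subgraph_def drop_isolated_def)
  have CG: "C \<in> connected_components G"
    unfolding C_eq connected_components_def using uV by (auto intro: quotientI)
  obtain v where v: "{u, v} \<in> edges G" "u \<noteq> v" "v \<in> verts G"
    using u G by (fastforce simp: simple_graph_def nsets_2_eq insert_commute)
  have "{u, v} \<subseteq> ?S"
    using uV v by (auto simp: connected_in_def)
  moreover have "finite ?S" "card ?S \<le> card {u, v}"
    using finV v \<open>\<not> card (verts C) \<ge> 3\<close>
    by (auto simp: C_eq induced_subgraph_def connected_in_def intro: finite_subset[of _ "verts G"])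
  ultimately have Suv: "?S = {u, v}"
    by (metis card_seteq)
  have "graph_iso C (complete_graph 2)"
    unfolding graph_iso_def
  proof (intro exI conjI)
    show "bij_betw (\<lambda>x. if x = u then 1 else 2) (verts C) (verts (complete_graph 2))"
      using v by (auto simp: C_eq Suv induced_subgraph_def complete_graph_def bij_betw_def)
    have "{x} \<notin> edges G" "{y, y} \<notin> edges G" for x y
      using G by (auto simp: simple_graph_def nsets_def)
    then show "\<forall>x\<in>verts C. \<forall>y\<in>verts C. {x, y} \<in> edges C
        \<longleftrightarrow> {if x = u then 1 else 2, if y = u then 1 else 2} \<in> edges (complete_graph 2)"
      using v by (auto simp: C_eq Suv induced_subgraph_def complete_graph_def insert_commute nsets_def)
  qed
  then show False
    using K2 CG by blast
qed

lemma card_component_le: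
  assumes "simple_graph G" "v \<in> verts G"
  shows "\<exists>C\<in>connected_components G. card (verts C) \<le> card (verts G)"
proof (intro bexI)
  show "induced_subgraph G (connected_in G `` {v}) \<in> connected_components G"
    using assms by (auto simp: connected_components_def intro: quotientI)
  show "card (verts (induced_subgraph G (connected_in G `` {v}))) \<le> card (verts G)"
    using assms by (auto simp: induced_subgraph_def connected_in_def simple_graph_def intro!: card_mono)
qed

section \<open>The equivalence\<close>

theorem theorem2p12:
  fixes e :: "nat \<Rightarrow> nat set"
  assumes "\<And>n. n \<ge> 2 \<Longrightarrow> e n \<in> edges (complete_graph n)"
  shows
    "(\<forall>G :: 'a ugraph. simple_graph G \<and> (\<forall>C \<in> connected_components G. \<not> card (verts C) < 3)
        \<longrightarrow> (\<exists>l. local_irregular_labeling G 3 l))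
     \<longleftrightarrow>
     (\<forall>G :: 'a ugraph. simple_graph G \<and> card (verts G) \<ge> 2
          \<and> (\<forall>C \<in> connected_components G. \<not> graph_iso C (complete_graph 2))
        \<longrightarrow> (\<exists>p \<in> weight_sum ` ({wgraph_of G}
                        \<star> C_upto (e (card (verts G))) 3 (card (verts G))
                        \<star> {M (card (verts G))}).
              \<not> (\<exists>i. coeff p i \<noteq> 0 \<and> Re (coeff p i) = 0)))"
    (is "?i \<longleftrightarrow> ?ii")
proof -
  have e: "e n \<in> nsets {1..n} 2" if "n \<ge> 2" for n
    using assms[OF that] by (simp add: complete_graph_def)
  note polynomial = local_irregular_labeling_iff_polynomial[OF _ refl _ e, where k = 3, simplified]
  show ?thesis
  proof
    assume i: ?i
    show ?ii
    proof (intro allI impI)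
      fix G :: "'a ugraph"
      assume G: "simple_graph G \<and> card (verts G) \<ge> 2
          \<and> (\<forall>C \<in> connected_components G. \<not> graph_iso C (complete_graph 2))"
      then have "\<exists>l. local_irregular_labeling (drop_isolated G) 3 l"
        using i simple_graph_drop_isolated drop_isolated_component_card by (metis not_less)
      then show "\<exists>p \<in> weight_sum ` ({wgraph_of G}
                        \<star> C_upto (e (card (verts G))) 3 (card (verts G))
                        \<star> {M (card (verts G))}).
              \<not> (\<exists>i. coeff p i \<noteq> 0 \<and> Re (coeff p i) = 0)"
        using G polynomial[of G] by (simp add: local_irregular_labeling_drop_isolated)
    qed
  next
    assume ii: ?ii
    show ?i
    proof (intro allI impI)
      fix G :: "'a ugraph"
      assume G: "simple_graph G \<and> (\<forall>C \<in> connected_components G. \<not> card (verts C) < 3)"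
      show "\<exists>l. local_irregular_labeling G 3 l"
      proof (cases "verts G = {}")
        case True
        then have "edges G = {}"
          using G by (auto simp: simple_graph_def nsets_def)
        then show ?thesis
          by (simp add: local_irregular_labeling_def)
      next
        case False
        then have "card (verts G) \<ge> 2"
          using G card_component_le by fastforce
        moreover have "\<not> graph_iso C (complete_graph 2)" if "C \<in> connected_components G" for C
          using G that graph_iso_complete_graph_2_card by fastforce
        ultimately show ?thesis
          using G ii polynomial[of G] by simp
      qed
    qed
  qed
qed

end
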